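(* Let $A\in 2^\omega$ be $\Delta^0_2$ and Martin-Löf random with respect to Lebesgue measure. Then there is a trivial computable probability measure $\mu$ on $2^\omega$ such that (i) $\mathsf{MLR}^A_\mu=\mathsf{Atoms}_\mu$, and (ii) $\mathsf{MLR}_\mu\setminus\mathsf{MLR}^A_\mu\neq\emptyset$.
   Context: $2^\omega$ is Cantor space (infinite binary sequences), $2^{<\omega}$ the set of finite binary strings, and $[\![\sigma]\!]$ the set of $X\in 2^\omega$ extending $\sigma$. A probability measure $\mu$ on $2^\omega$ is computable if $\sigma\mapsto\mu([\![\sigma]\!])$ is a computable real-valued function, i.e. there is a computable function $\widehat\mu:2^{<\omega}\times\omega\to\mathbb{Q}_2$ (dyadic rationals) with $|\mu([\![\sigma]\!])-\widehat\mu(\sigma,i)|\le 2^{-i}$ for all $\sigma,i$. Lebesgue measure is the measure $\lambda$ with $\lambda([\![\sigma]\!])=2^{-|\sigma|}$. $\mathsf{Atoms}_\mu=\{A\in 2^\omega:\mu(\{A\})>0\}$, and $\mu$ is trivial if $\mu(\mathsf{Atoms}_\mu)=1$. For $A\in 2^\omega$, a $\mu$-Martin-Löf test relative to $A$ is a sequence $(\mathcal U_i)_{i\in\omega}$ of uniformly $\Sigma^{0}_1$-in-$A$ subsets of $2^\omega$ with $\mu(\mathcal U_i)\le 2^{-i}$ for all $i$; $\mathsf{MLR}^A_\mu$ is the set of $X\in 2^\omega$ with $X\notin\bigcap_i\mathcal U_i$ for every such test. $\mathsf{MLR}_\mu=\mathsf{MLR}_\mu^\emptyset$ is the set of $\mu$-Martin-Löf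 random sequences. *)

theory Defs
  imports "HOL-Probability.Probability" "HOL-Library.Nat_Bijection"
begin

section \<open>Computability relative to an oracle\<close>

text \<open>
  Kleene's codes for the partial recursive functions, with one additional initial function that
  queries the oracle. \<open>run A e xs y\<close> says that program \<open>e\<close>, with oracle \<open>A\<close>, halts on the argument
  tuple \<open>xs\<close> with output \<open>y\<close>.
\<close>

datatype recf =
    Zero
  | Succ
  | Proj nat
  | Query
  | Comp recf "recf list"
  | Prec recf recf
  | Mini recf

inductive run :: "(nat \<Rightarrow> bool) \<Rightarrow> recf \<Rightarrow> nat list \<Rightarrow> nat \<Rightarrow> bool"
  for A :: "nat \<Rightarrow> bool" where
  run_Zero: "run A Zero xs 0"
| run_Succ: "run A Succ [x] (Suc x)"
| run_Proj: "i < length xs \<Longrightarrow> run A (Proj i) xs (xs ! i)"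
| run_Query: "run A Query [x] (of_bool (A x))"
| run_Comp: "list_all2 (\<lambda>g y. run A g xs y) gs ys \<Longrightarrow> run A f ys z \<Longrightarrow> run A (Comp f gs) xs z"
| run_Prec_0: "run A f xs y \<Longrightarrow> run A (Prec f g) (0 # xs) y"
| run_Prec_Suc: "run A (Prec f g) (n # xs) y \<Longrightarrow> run A g (n # y # xs) z
    \<Longrightarrow> run A (Prec f g) (Suc n # xs) z"
| run_Mini: "run A f (y # xs) 0 \<Longrightarrow> \<forall>z<y. \<exists>v>0. run A f (z # xs) v \<Longrightarrow> run A (Mini f) xs y"

inductive_cases run_ZeroE: "run A Zero xs z"
inductive_cases run_SuccE: "run A Succ xs z"
inductive_cases run_ProjE: "run A (Proj i) xs z"
inductive_cases run_QueryE: "run A Query xs z"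
inductive_cases run_CompE: "run A (Comp f gs) xs z"
inductive_cases run_Prec_0E: "run A (Prec f g) (0 # xs) z"
inductive_cases run_Prec_SucE: "run A (Prec f g) (Suc n # xs) z"
inductive_cases run_MiniE: "run A (Mini f) xs z"

lemma run_deterministic: "run A e xs y \<Longrightarrow> run A e xs z \<Longrightarrow> y = z"
proof (induction arbitrary: z rule: run.induct)
  case (run_Zero xs)
  then show ?case by (blast elim: run_ZeroE)
next
  case (run_Succ x)
  then show ?case by (auto elim: run_SuccE)
next
  case (run_Proj i xs)
  from run_Proj.prems show ?case by (blast elim: run_ProjE)
next
  case (run_Query x)
  then show ?case by (auto elim: run_QueryE)
next
  case (run_Comp xs gs ys f w)
  from run_Comp.prems obtain ys' where
    ys': "list_all2 (\<lambda>g y. run A g xs y) gs ys'" "run A f ys' z"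
    by (rule run_CompE)
  have "ys = ys'"
    using run_Comp.IH(1) ys'(1) by (auto simp: list_all2_conv_all_nth intro: nth_equalityI)
  with ys' run_Comp.IH show ?case by blast
next
  case (run_Prec_0 f xs y g)
  from run_Prec_0.prems run_Prec_0.IH show ?case by (blast elim: run_Prec_0E)
next
  case (run_Prec_Suc f g n xs y w)
  from run_Prec_Suc.prems obtain y' where "run A (Prec f g) (n # xs) y'" "run A g (n # y' # xs) z"
    by (rule run_Prec_SucE)
  with run_Prec_Suc.IH show ?case by blast
next
  case (run_Mini f y xs)
  from run_Mini.prems have z: "run A f (z # xs) 0" "\<forall>u<z. \<exists>v>0. run A f (u # xs) v"
    by (blast elim: run_MiniE)+
  show ?case
  proof (cases y z rule: linorder_cases)
    case less
    with z(2) obtain v where "v > 0" "run A f (y # xs) v" by blast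
    with run_Mini.IH(1) show ?thesis by blast
  next
    case greater
    with run_Mini.IH(2) obtain v where "v > 0" "\<forall>w. run A f (z # xs) w \<longrightarrow> v = w" by blast
    with z(1) show ?thesis by blast
  qed
qed

text \<open>Total computability of a \<open>k\<close>-ary function; its values on tuples of other lengths are irrelevant.\<close>

definition computable_in :: "(nat \<Rightarrow> bool) \<Rightarrow> nat \<Rightarrow> (nat list \<Rightarrow> nat) \<Rightarrow> bool" where
  "computable_in A k f \<longleftrightarrow> (\<exists>e. \<forall>xs. length xs = k \<longrightarrow> run A e xs (f xs))"

definition decidable_in :: "(nat \<Rightarrow> bool) \<Rightarrow> nat \<Rightarrow> (nat list \<Rightarrow> bool) \<Rightarrow> bool" where
  "decidable_in A k R \<longleftrightarrow> computable_in A k (\<lambda>xs. of_bool (R xs))"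

abbreviation no_oracle :: "nat \<Rightarrow> bool" where
  "no_oracle \<equiv> \<lambda>_. False"

definition Sigma02 :: "(nat \<Rightarrow> bool) \<Rightarrow> bool" where
  "Sigma02 A \<longleftrightarrow> (\<exists>R. decidable_in no_oracle 3 R \<and> (\<forall>n. A n \<longleftrightarrow> (\<exists>x. \<forall>y. R [n, x, y])))"

definition Pi02 :: "(nat \<Rightarrow> bool) \<Rightarrow> bool" where
  "Pi02 A \<longleftrightarrow> (\<exists>R. decidable_in no_oracle 3 R \<and> (\<forall>n. A n \<longleftrightarrow> (\<forall>x. \<exists>y. R [n, x, y])))"

definition Delta02 :: "(nat \<Rightarrow> bool) \<Rightarrow> bool" where
  "Delta02 A \<longleftrightarrow> Sigma02 A \<and> Pi02 A"


section \<open>Cantor space\<close>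

definition cylinder :: "bool list \<Rightarrow> (nat \<Rightarrow> bool) set" where
  "cylinder \<sigma> = {X. \<forall>i<length \<sigma>. X i = \<sigma> ! i}"

text \<open>Only the \<open>\<sigma>\<close>-algebra of the following measure matters: it is generated by the cylinders.\<close>

definition cantor_space :: "(nat \<Rightarrow> bool) measure" where
  "cantor_space = (\<Pi>\<^sub>M i\<in>UNIV. count_space UNIV)"

definition cantor_prob :: "(nat \<Rightarrow> bool) measure \<Rightarrow> bool" where
  "cantor_prob \<mu> \<longleftrightarrow> prob_space \<mu> \<and> sets \<mu> = sets cantor_space"

lemma cylinder_measurable [measurable]: "cylinder \<sigma> \<in> sets cantor_space"
proof -
  have "{X \<in> space cantor_space. \<forall>i\<in>{..<length \<sigma>}. X i = \<sigma> ! i} \<in> sets cantor_space"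
    unfolding cantor_space_def by measurable
  also have "{X \<in> space cantor_space. \<forall>i\<in>{..<length \<sigma>}. X i = \<sigma> ! i} = cylinder \<sigma>"
    by (auto simp: cylinder_def cantor_space_def space_PiM)
  finally show ?thesis .
qed

lemma singleton_measurable: "{X} \<in> sets cantor_space"
proof -
  have "{Y \<in> space cantor_space. \<forall>i. Y i = X i} \<in> sets cantor_space"
    unfolding cantor_space_def by measurable
  also have "{Y \<in> space cantor_space. \<forall>i. Y i = X i} = {X}"
    by (auto simp: cantor_space_def space_PiM)
  finally show ?thesis .
qed

text \<open>Lebesgue measure: independent fair coin tosses.\<close>

definition cantor_lebesgue :: "(nat \<Rightarrow> bool) measure" where
  "cantor_lebesgue = (\<Pi>\<^sub>M i\<in>UNIV. measure_pmf (pmf_of_set UNIV))"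

lemma cantor_prob_lebesgue: "cantor_prob cantor_lebesgue"
proof -
  interpret product_prob_space "\<lambda>_::nat. measure_pmf (pmf_of_set (UNIV::bool set))" UNIV
    by unfold_locales
  have "prob_space cantor_lebesgue"
    unfolding cantor_lebesgue_def by unfold_locales
  moreover have "sets cantor_lebesgue = sets cantor_space"
    unfolding cantor_lebesgue_def cantor_space_def by (rule sets_PiM_cong) simp_all
  ultimately show ?thesis by (simp add: cantor_prob_def)
qed

lemma measure_lebesgue_cylinder: "measure cantor_lebesgue (cylinder \<sigma>) = (1/2) ^ length \<sigma>"
proof -
  interpret product_prob_space "\<lambda>_::nat. measure_pmf (pmf_of_set (UNIV::bool set))" UNIV
    by unfold_locales
  have "cylinder \<sigma> = prod_emb UNIV (\<lambda>_::nat. measure_pmf (pmf_of_set (UNIV::bool set)))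
      {..<length \<sigma>} (\<Pi>\<^sub>E i\<in>{..<length \<sigma>}. {\<sigma> ! i})"
  proof (rule set_eqI)
    fix X :: "nat \<Rightarrow> bool"
    have "X \<in> prod_emb UNIV (\<lambda>_::nat. measure_pmf (pmf_of_set (UNIV::bool set)))
        {..<length \<sigma>} (\<Pi>\<^sub>E i\<in>{..<length \<sigma>}. {\<sigma> ! i})
      \<longleftrightarrow> restrict X {..<length \<sigma>} \<in> (\<Pi>\<^sub>E i\<in>{..<length \<sigma>}. {\<sigma> ! i})"
      by (simp add: prod_emb_def)
    also have "\<dots> \<longleftrightarrow> (\<forall>i<length \<sigma>. X i = \<sigma> ! i)"
      unfolding PiE_iff by auto
    finally show "X \<in> cylinder \<sigma> \<longleftrightarrow> X \<in> prod_emb UNIV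
        (\<lambda>_::nat. measure_pmf (pmf_of_set (UNIV::bool set)))
        {..<length \<sigma>} (\<Pi>\<^sub>E i\<in>{..<length \<sigma>}. {\<sigma> ! i})"
      unfolding cylinder_def by simp
  qed
  then have "measure cantor_lebesgue (cylinder \<sigma>)
      = (\<Prod>i<length \<sigma>. measure (measure_pmf (pmf_of_set UNIV)) {\<sigma> ! i})"
    unfolding cantor_lebesgue_def by (simp add: measure_PiM_emb)
  then show ?thesis by (simp add: measure_pmf_single)
qed

text \<open>
  A bijection between binary strings and natural numbers: the binary digits of
  \<open>Suc (str_code \<sigma>)\<close>, from least to most significant, are \<open>\<sigma>\<close> followed by \<open>1\<close>.
\<close>

primrec str_code :: "bool list \<Rightarrow> nat" where
  "str_code [] = 0"
| "str_code (b # \<sigma>) = 2 * str_code \<sigma> + (if b then 2 else 1)"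

lemma bij_str_code: "bij str_code"
proof (rule bijI)
  have "str_code \<sigma> = str_code \<tau> \<Longrightarrow> \<sigma> = \<tau>" for \<sigma> \<tau>
  proof (induction \<sigma> arbitrary: \<tau>)
    case Nil
    then show ?case by (cases \<tau>) (auto split: if_splits)
  next
    case (Cons b \<sigma>)
    show ?case
    proof (cases \<tau>)
      case Nil
      with Cons.prems show ?thesis by (auto split: if_splits)
    next
      case (Cons c \<rho>)
      with Cons.prems have "b = c \<and> str_code \<sigma> = str_code \<rho>"
        by (cases b; cases c; simp; presburger)
      with Cons Cons.IH show ?thesis by blast
    qed
  qed
  then show "inj str_code" by (rule injI)
  have "\<exists>\<sigma>. str_code \<sigma> = n" for n
  proof (induction n rule: less_induct)
    case (less n)
    consider "n = 0" | m where "n = 2 * m + 1" | m where "n = 2 * m + 2"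
    proof -
      have "n = 0 \<or> n = 2 * ((n - 1) div 2) + 1 \<or> n = 2 * ((n - 1) div 2) + 2"
        by presburger
      then show ?thesis using that by blast
    qed
    then show ?case
    proof cases
      case 1
      then show ?thesis by (intro exI[of _ "[]"]) simp
    next
      case (2 m)
      with less[of m] obtain \<sigma> where "str_code \<sigma> = m" by auto
      with 2 show ?thesis by (intro exI[of _ "False # \<sigma>"]) simp
    next
      case (3 m)
      with less[of m] obtain \<sigma> where "str_code \<sigma> = m" by auto
      with 3 show ?thesis by (intro exI[of _ "True # \<sigma>"]) simp
    qed
  qed
  then show "surj str_code" unfolding surj_def by metis
qed

text \<open>
  A dyadic rational \<open>m / 2 ^ d\<close> is presented by \<open>m :: int\<close>, coded by \<open>int_encode\<close>, and \<open>d :: nat\<close>.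
\<close>

definition computable_dyadic :: "(bool list \<Rightarrow> nat \<Rightarrow> real) \<Rightarrow> bool" where
  "computable_dyadic q \<longleftrightarrow> (\<exists>num den.
     computable_in no_oracle 2 num \<and> computable_in no_oracle 2 den \<and>
     (\<forall>\<sigma> i. q \<sigma> i = of_int (int_decode (num [str_code \<sigma>, i])) / 2 ^ den [str_code \<sigma>, i]))"

definition computable_measure :: "(nat \<Rightarrow> bool) measure \<Rightarrow> bool" where
  "computable_measure \<mu> \<longleftrightarrow>
     (\<exists>q. computable_dyadic q \<and> (\<forall>\<sigma> i. \<bar>measure \<mu> (cylinder \<sigma>) - q \<sigma> i\<bar> \<le> (1/2) ^ i))"

definition Atoms :: "(nat \<Rightarrow> bool) measure \<Rightarrow> (nat \<Rightarrow> bool) set" where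
  "Atoms \<mu> = {X. measure \<mu> {X} > 0}"

definition trivial_measure :: "(nat \<Rightarrow> bool) measure \<Rightarrow> bool" where
  "trivial_measure \<mu> \<longleftrightarrow> measure \<mu> (Atoms \<mu>) = 1"


section \<open>Martin-Loef randomness\<close>

text \<open>
  A \<open>\<Sigma>\<^sup>0\<^sub>1\<close>-in-\<open>A\<close> subset of Cantor space is the union of the cylinders over a \<open>\<Sigma>\<^sup>0\<^sub>1\<close>-in-\<open>A\<close> set of
  strings, here \<open>{\<sigma>. \<exists>s. R [i, str_code \<sigma>, s]}\<close>; uniformity is the dependence of \<open>R\<close> on \<open>i\<close>.
\<close>

definition uniformly_Sigma01_in :: "(nat \<Rightarrow> bool) \<Rightarrow> (nat \<Rightarrow> (nat \<Rightarrow> bool) set) \<Rightarrow> bool" where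
  "uniformly_Sigma01_in A U \<longleftrightarrow> (\<exists>R. decidable_in A 3 R \<and>
     (\<forall>i. U i = (\<Union>\<sigma>\<in>{\<sigma>. \<exists>s. R [i, str_code \<sigma>, s]}. cylinder \<sigma>)))"

definition martin_loef_test :: "(nat \<Rightarrow> bool) measure \<Rightarrow> (nat \<Rightarrow> bool) \<Rightarrow> (nat \<Rightarrow> (nat \<Rightarrow> bool) set) \<Rightarrow> bool" where
  "martin_loef_test \<mu> A U \<longleftrightarrow> uniformly_Sigma01_in A U \<and> (\<forall>i. measure \<mu> (U i) \<le> (1/2) ^ i)"

definition MLR_in :: "(nat \<Rightarrow> bool) measure \<Rightarrow> (nat \<Rightarrow> bool) \<Rightarrow> (nat \<Rightarrow> bool) set" where
  "MLR_in \<mu> A = {X. \<forall>U. martin_loef_test \<mu> A U \<longrightarrow> X \<notin> (\<Inter>i. U i)}"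

definition MLR :: "(nat \<Rightarrow> bool) measure \<Rightarrow> (nat \<Rightarrow> bool) set" where
  "MLR \<mu> = MLR_in \<mu> no_oracle"

text \<open>
  The sets measured above are measurable, so that the convention giving non-measurable sets
  measure \<open>0\<close> plays no role.
\<close>

lemma uniformly_Sigma01_in_measurable:
  assumes "cantor_prob \<mu>" "uniformly_Sigma01_in A U"
  shows "U i \<in> sets \<mu>"
proof -
  from assms(2) obtain R where "U i = (\<Union>\<sigma>\<in>{\<sigma>. \<exists>s. R [i, str_code \<sigma>, s]}. cylinder \<sigma>)"
    unfolding uniformly_Sigma01_in_def by (elim exE conjE) (drule spec)
  moreover have "(\<Union>\<sigma>\<in>{\<sigma>. \<exists>s. R [i, str_code \<sigma>, s]}. cylinder \<sigma>) \<in> sets \<mu>"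
  proof (rule sets.countable_UN'')
    show "cylinder \<sigma> \<in> sets \<mu>" for \<sigma>
      using assms(1) cylinder_measurable unfolding cantor_prob_def by blast
  qed (rule countableI_type)
  ultimately show ?thesis by (simp only:)
qed

lemma Atoms_measurable:
  assumes "cantor_prob \<mu>"
  shows "Atoms \<mu> \<in> sets \<mu>"
proof -
  interpret prob_space \<mu> using assms by (simp add: cantor_prob_def)
  have "countable (Atoms \<mu>)"
    using countable_support by (simp add: Atoms_def zero_less_measure_iff)
  moreover have "{X} \<in> sets \<mu>" for X
    using assms singleton_measurable by (simp add: cantor_prob_def)
  ultimately have "(\<Union>X\<in>Atoms \<mu>. {X}) \<in> sets \<mu>"
    by (intro sets.countable_UN') auto
  then show ?thesis by simp
qed

end

theory Submission
  imports Defs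
begin

text \<open>
  Let \<open>ap n s\<close> be a computable approximation of \<open>A n\<close> as \<open>s \<rightarrow> \<infinity>\<close>. Map \<open>X\<close> to the sequence of answers to
  the questions whether \<open>X\<close> agrees with stage \<open>s\<close> of the approximation up to position \<open>n\<close>, for
  \<open>n \<le> s\<close>, and let \<open>\<mu>\<close> be the image of Lebesgue measure. If \<open>X \<noteq> A\<close>, agreement with the late stages
  stops at the first difference, so the image of \<open>X\<close> is determined by a finite part of \<open>X\<close> and is an
  atom. The image of \<open>A\<close> has \<open>A\<close> as its only preimage, so it is not an atom, but it is random because
  tests pull back along the map. Relative to \<open>A\<close> one recognises agreement with a correct stage, and
  this yields a test capturing every sequence that is not an atom.
\<close>

section \<open>Closure properties of the computable functions\<close>

text \<open>Functions of an environment rather than of a list: the variables of a term become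
  \<open>e 0\<close>, \<open>e 1\<close> and so on, as de Bruijn indices, so that computability can
  be derived by following the syntax of the term.\<close>

definition env_computable :: "(nat \<Rightarrow> bool) \<Rightarrow> nat \<Rightarrow> ((nat \<Rightarrow> nat) \<Rightarrow> nat) \<Rightarrow> bool" where
  "env_computable A k f \<longleftrightarrow> computable_in A k (\<lambda>xs. f (nth xs))"

lemma computable_in_compose:
  assumes f: "computable_in A (length gs) f" and gs: "\<And>g. g \<in> set gs \<Longrightarrow> computable_in A k g"
  shows "computable_in A k (\<lambda>xs. f (map (\<lambda>g. g xs) gs))"
proof -
  from f obtain p where p: "length ys = length gs \<Longrightarrow> run A p ys (f ys)" for ys
    unfolding computable_in_def by auto
  from gs obtain q where q: "g \<in> set gs \<Longrightarrow> length xs = k \<Longrightarrow> run A (q g) xs (g xs)" for g xs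
    unfolding computable_in_def by metis
  have "run A (Comp p (map q gs)) xs (f (map (\<lambda>g. g xs) gs))" if "length xs = k" for xs
    using q[OF _ that] by (intro run_Comp[OF _ p]) (auto simp: list_all2_conv_all_nth)
  then show ?thesis unfolding computable_in_def by blast
qed

lemma env_computable_app1:
  assumes "computable_in A 1 f" "env_computable A k F"
  shows "env_computable A k (\<lambda>e. f [F e])"
  using computable_in_compose[of A "[\<lambda>xs. F (nth xs)]" f k] assms
  by (simp add: env_computable_def)

lemma env_computable_app2:
  assumes "computable_in A 2 f" "env_computable A k F" "env_computable A k G"
  shows "env_computable A k (\<lambda>e. f [F e, G e])"
  using computable_in_compose[of A "[\<lambda>xs. F (nth xs), \<lambda>xs. G (nth xs)]" f k] assms
  by (auto simp add: env_computable_def numeral_2_eq_2)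

lemma env_computable_app3:
  assumes "computable_in A 3 f" "env_computable A k F" "env_computable A k G" "env_computable A k H"
  shows "env_computable A k (\<lambda>e. f [F e, G e, H e])"
  using computable_in_compose[of A "[\<lambda>xs. F (nth xs), \<lambda>xs. G (nth xs), \<lambda>xs. H (nth xs)]" f k] assms
  by (auto simp add: env_computable_def numeral_3_eq_3)

lemma computable_in_nth: "i < k \<Longrightarrow> computable_in A k (\<lambda>xs. xs ! i)"
  unfolding computable_in_def by (auto intro!: exI[of _ "Proj i"] run_Proj)

lemma env_computable_var: "i < k \<Longrightarrow> env_computable A k (\<lambda>e. e i)"
  unfolding env_computable_def by (rule computable_in_nth)

lemma env_computable_Suc:
  assumes "env_computable A k F"
  shows "env_computable A k (\<lambda>e. Suc (F e))"
proof -
  have "run A Succ xs (Suc (hd xs))" if "length xs = 1" for xs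
    using that run_Succ[of A "hd xs"] by (cases xs) auto
  then have "computable_in A 1 (\<lambda>xs. Suc (hd xs))"
    unfolding computable_in_def by blast
  from env_computable_app1[OF this assms] show ?thesis by simp
qed

lemma env_computable_oracle:
  assumes "env_computable A k F"
  shows "env_computable A k (\<lambda>e. of_bool (A (F e)))"
proof -
  have "run A Query xs (of_bool (A (hd xs)))" if "length xs = 1" for xs
    using that run_Query[of A "hd xs"] by (cases xs) auto
  then have "computable_in A 1 (\<lambda>xs. of_bool (A (hd xs)))"
    unfolding computable_in_def by blast
  from env_computable_app1[OF this assms] show ?thesis by simp
qed

lemma env_computable_0: "env_computable A k (\<lambda>e. 0)"
  unfolding env_computable_def computable_in_def by (blast intro: run_Zero)

lemma env_computable_nat: "env_computable A k (\<lambda>e. n)"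
  by (induction n) (auto intro: env_computable_0 env_computable_Suc)

text \<open>Weakening: index 0 is a newly bound variable that \<open>F\<close> ignores, so composing
  with the projections from index 1 on suffices.\<close>

lemma env_computable_shift:
  assumes "env_computable A k F"
  shows "env_computable A (Suc k) (\<lambda>e. F (\<lambda>j. e (Suc j)))"
proof -
  have "computable_in A (Suc k) (\<lambda>xs. F (nth (map (\<lambda>g. g xs) (map (\<lambda>i xs. xs ! Suc i) [0..<k]))))"
    using assms by (intro computable_in_compose) (auto simp: env_computable_def intro: computable_in_nth)
  \<comment> \<open>The environments must be equal also beyond the end of the list, because
    \<open>F\<close> may inspect any index. This holds since \<open>nth\<close> of a nonempty list
    at \<open>Suc j\<close> is \<open>nth\<close> of its tail at \<open>j\<close>.\<close>
  moreover have "(\<lambda>j. xs ! Suc j) = nth (map (\<lambda>g. g xs) (map (\<lambda>i xs. xs ! Suc i) [0..<k]))"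
    if xs: "length xs = Suc k" for xs :: "nat list"
  proof -
    have "map (\<lambda>g. g xs) (map (\<lambda>i xs. xs ! Suc i) [0..<k]) = tl xs"
      using xs by (intro nth_equalityI) (auto simp: nth_tl)
    with xs show ?thesis by (cases xs) auto
  qed
  ultimately show ?thesis
    unfolding env_computable_def computable_in_def by auto
qed

text \<open>\<open>Prec\<close> passes the counter and the previous value in front of the
  parameters, hence the two bound variables of \<open>H\<close>. Composing with \<open>N\<close> and
  all projections then substitutes the recursion argument while keeping the parameters.\<close>

lemma env_computable_rec:
  assumes G: "env_computable A k G"
    and H: "env_computable A (Suc (Suc k)) (\<lambda>e. H (e 0) (e 1) (\<lambda>j. e (Suc (Suc j))))"
    and N: "env_computable A k N"
  shows "env_computable A k (\<lambda>e. rec_nat (G e) (\<lambda>n y. H n y e) (N e))"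
proof -
  from G obtain p where p: "length xs = k \<Longrightarrow> run A p xs (G (nth xs))" for xs
    unfolding env_computable_def computable_in_def by auto
  from H obtain q where
    q: "length ys = Suc (Suc k) \<Longrightarrow> run A q ys (H (ys ! 0) (ys ! 1) (\<lambda>j. ys ! Suc (Suc j)))" for ys
    unfolding env_computable_def computable_in_def by auto
  have "run A (Prec p q) (n # xs) (rec_nat (G (nth xs)) (\<lambda>n y. H n y (nth xs)) n)"
    if "length xs = k" for n xs
  proof (induction n)
    case 0
    show ?case using p[OF that] by (auto intro: run_Prec_0)
  next
    case (Suc n)
    show ?case
      using run_Prec_Suc[OF Suc q] that by auto
  qed
  then have "run A (Prec p q) xs
      (rec_nat (G (nth (tl xs))) (\<lambda>n y. H n y (nth (tl xs))) (hd xs))" if "length xs = Suc k" for xs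
    using that by (cases xs) auto
  then have *: "computable_in A (Suc k)
      (\<lambda>xs. rec_nat (G (nth (tl xs))) (\<lambda>n y. H n y (nth (tl xs))) (hd xs))"
    unfolding computable_in_def by blast
  let ?gs = "(\<lambda>xs. N (nth xs)) # map (\<lambda>i xs. xs ! i) [0..<k]"
  have "computable_in A k (\<lambda>xs. (\<lambda>xs. rec_nat (G (nth (tl xs))) (\<lambda>n y. H n y (nth (tl xs))) (hd xs))
      (map (\<lambda>g. g xs) ?gs))"
    using N * by (intro computable_in_compose) (auto simp: env_computable_def intro: computable_in_nth)
  moreover have "map (\<lambda>i. xs ! i) [0..<k] = xs" if "length xs = k" for xs :: "nat list"
    using that map_nth by blast
  ultimately show ?thesis
    unfolding env_computable_def computable_in_def by (auto simp: comp_def)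
qed

text \<open>\<open>Mini\<close> finds the least zero: \<open>F\<close> is total, so every value
  before the zero is defined and positive, and \<open>ex\<close> makes the search halt.\<close>

lemma env_computable_Least:
  assumes F: "env_computable A (Suc k) (\<lambda>e. F (e 0) (\<lambda>j. e (Suc j)))"
    and ex: "\<And>e. \<exists>y. F y e = 0"
  shows "env_computable A k (\<lambda>e. LEAST y. F y e = 0)"
proof -
  from F obtain p where
    p: "length ys = Suc k \<Longrightarrow> run A p ys (F (ys ! 0) (\<lambda>j. ys ! Suc j))" for ys
    unfolding env_computable_def computable_in_def by auto
  have "run A (Mini p) xs (LEAST y. F y (nth xs) = 0)" if "length xs = k" for xs
  proof (rule run_Mini)
    have *: "run A p (y # xs) (F y (nth xs))" for y
      using p[of "y # xs"] that by simp
    show "run A p ((LEAST y. F y (nth xs) = 0) # xs) 0"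
      using *[of "LEAST y. F y (nth xs) = 0"] LeastI_ex[OF ex] by simp
    show "\<forall>z<LEAST y. F y (nth xs) = 0. \<exists>v>0. run A p (z # xs) v"
      using * not_less_Least by blast
  qed
  then show ?thesis unfolding env_computable_def computable_in_def by blast
qed

section \<open>Arithmetic and bounded sums\<close>

lemma env_computable_add:
  assumes "env_computable A k F" "env_computable A k G"
  shows "env_computable A k (\<lambda>e. F e + G e)"
proof -
  have "rec_nat a (\<lambda>_ y. Suc y) b = a + b" for a b by (induction b) auto
  moreover have "env_computable A k (\<lambda>e. rec_nat (F e) (\<lambda>n y. Suc y) (G e))"
    using assms by (intro env_computable_rec env_computable_Suc env_computable_var) auto
  ultimately show ?thesis by simp
qed

lemma env_computable_diff:
  assumes "env_computable A k F" "env_computable A k G"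
  shows "env_computable A k (\<lambda>e. F e - G e)"
proof -
  \<comment> \<open>The inner recursion is the predecessor; iterating it gives truncated
    subtraction.\<close>
  have "rec_nat 0 (\<lambda>n _. n) y = y - 1" for y by (cases y) auto
  then have "rec_nat a (\<lambda>_ y. rec_nat 0 (\<lambda>n _. n) y) b = a - b" for a b by (induction b) auto
  moreover have "env_computable A k (\<lambda>e. rec_nat (F e) (\<lambda>n y. rec_nat 0 (\<lambda>n _. n) y) (G e))"
    using assms by (intro env_computable_rec env_computable_0 env_computable_var) auto
  ultimately show ?thesis by simp
qed

lemma env_computable_sum:
  assumes "env_computable A (Suc k) (\<lambda>e. F (e 0) (\<lambda>j. e (Suc j)))" "env_computable A k N"
  shows "env_computable A k (\<lambda>e. \<Sum>i<N e. F i e)"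
proof -
  have "rec_nat 0 (\<lambda>n y. y + f n) m = sum f {..<m}" for f :: "nat \<Rightarrow> nat" and m
    by (induction m) auto
  moreover have "env_computable A k (\<lambda>e. rec_nat 0 (\<lambda>n y. y + F n e) (N e))"
  proof (intro env_computable_rec env_computable_0 env_computable_add env_computable_var assms)
    \<comment> \<open>The summand uses the counter, index 0, and the parameters, from index 2 on,
      but skips the accumulator at index 1. Shifting does not cover this, so the projections are
      composed by hand.\<close>
    from assms(1) have "computable_in A (Suc k) (\<lambda>xs. F (xs ! 0) (\<lambda>j. xs ! Suc j))"
      by (simp add: env_computable_def)
    then have "computable_in A (Suc (Suc k)) (\<lambda>xs. (\<lambda>xs. F (xs ! 0) (\<lambda>j. xs ! Suc j))
        (map (\<lambda>g. g xs) ((\<lambda>xs. xs ! 0) # map (\<lambda>i xs. xs ! Suc (Suc i)) [0..<k])))"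
      by (intro computable_in_compose) (auto intro: computable_in_nth)
    moreover have "map (\<lambda>i. xs ! Suc (Suc i)) [0..<k] = tl (tl xs)"
      if "length xs = Suc (Suc k)" for xs :: "nat list"
      using that by (intro nth_equalityI) (auto simp: nth_tl)
    moreover have "(\<lambda>j. xs ! Suc (Suc j)) = nth (tl (tl xs))"
      if "length xs = Suc (Suc k)" for xs :: "nat list"
      using that by (cases xs; cases "tl xs") auto
    ultimately show "env_computable A (Suc (Suc k)) (\<lambda>e. F (e 0) (\<lambda>j. e (Suc (Suc j))))"
      unfolding env_computable_def computable_in_def by (auto simp: comp_def)
  qed auto
  ultimately show ?thesis by simp
qed

lemma env_computable_mult:
  assumes "env_computable A k F" "env_computable A k G"
  shows "env_computable A k (\<lambda>e. F e * G e)"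
proof -
  have "env_computable A k (\<lambda>e. \<Sum>i<G e. F e)"
    using env_computable_shift[OF assms(1)] assms(2) by (rule env_computable_sum)
  then show ?thesis by (simp add: mult.commute)
qed


lemma env_computable_power:
  assumes "env_computable A k F" "env_computable A k G"
  shows "env_computable A k (\<lambda>e. F e ^ G e)"
proof -
  have "rec_nat 1 (\<lambda>_ y. y * a) b = a ^ b" for a b :: nat by (induction b) auto
  moreover have "env_computable A k (\<lambda>e. rec_nat 1 (\<lambda>_ y. y * F e) (G e))"
    using assms
    by (intro env_computable_rec env_computable_nat env_computable_mult env_computable_var
        env_computable_shift[of _ "Suc k" "\<lambda>e. F (\<lambda>j. e (Suc j))"] env_computable_shift) auto
  ultimately show ?thesis by simp
qed

section \<open>Decidable relations and bounded quantifiers\<close>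

lemma env_decidable_le:
  assumes "env_computable A k F" "env_computable A k G"
  shows "env_computable A k (\<lambda>e. of_bool (F e \<le> G e))"
proof -
  have "of_bool (a \<le> b) = 1 - (a - b)" for a b :: nat by auto
  then show ?thesis
    using assms by (auto intro!: env_computable_diff env_computable_nat simp del: One_nat_def)
qed

lemma env_decidable_less:
  assumes "env_computable A k F" "env_computable A k G"
  shows "env_computable A k (\<lambda>e. of_bool (F e < G e))"
  using env_decidable_le[OF env_computable_Suc[OF assms(1)] assms(2)] by (simp add: Suc_le_eq)

lemma env_decidable_not:
  assumes "env_computable A k (\<lambda>e. of_bool (P e))"
  shows "env_computable A k (\<lambda>e. of_bool (\<not> P e))"
proof -
  have "of_bool (\<not> p) = 1 - (of_bool p :: nat)" for p by simp
  then show ?thesis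
    using assms by (simp only:) (intro env_computable_diff env_computable_nat)
qed

lemma env_decidable_conj:
  assumes "env_computable A k (\<lambda>e. of_bool (P e))" "env_computable A k (\<lambda>e. of_bool (Q e))"
  shows "env_computable A k (\<lambda>e. of_bool (P e \<and> Q e))"
  using env_computable_mult[OF assms] by (simp add: of_bool_conj)

lemma env_decidable_disj:
  assumes "env_computable A k (\<lambda>e. of_bool (P e))" "env_computable A k (\<lambda>e. of_bool (Q e))"
  shows "env_computable A k (\<lambda>e. of_bool (P e \<or> Q e))"
  using env_decidable_not[OF env_decidable_conj[OF assms[THEN env_decidable_not]]] by simp

lemma env_decidable_iff:
  assumes "env_computable A k (\<lambda>e. of_bool (P e))" "env_computable A k (\<lambda>e. of_bool (Q e))"
  shows "env_computable A k (\<lambda>e. of_bool (P e = Q e))"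
proof -
  have "(p = q) \<longleftrightarrow> (p \<and> q) \<or> (\<not> p \<and> \<not> q)" for p q by auto
  then show ?thesis
    using assms by (simp only:) (intro env_decidable_disj env_decidable_conj env_decidable_not)
qed

lemma env_decidable_eq:
  assumes "env_computable A k F" "env_computable A k G"
  shows "env_computable A k (\<lambda>e. of_bool (F e = G e))"
  using env_decidable_conj[OF env_decidable_le[OF assms] env_decidable_le[OF assms(2,1)]]
  by (simp add: order_eq_iff)

text \<open>The counterexamples below the bound are counted by a bounded sum, which is then compared
  with 0.\<close>

lemma env_decidable_all:
  assumes "env_computable A (Suc k) (\<lambda>e. of_bool (P (e 0) (\<lambda>j. e (Suc j))))"
    and "env_computable A k N"
  shows "env_computable A k (\<lambda>e. of_bool (\<forall>i<N e. P i e))"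
proof -
  have "env_computable A k (\<lambda>e. of_bool ((\<Sum>i<N e. of_bool (\<not> P i e)) = (0 :: nat)))"
    using assms by (intro env_decidable_eq env_computable_sum env_decidable_not env_computable_nat)
  moreover have "(\<Sum>i<n. of_bool (\<not> p i)) = (0 :: nat) \<longleftrightarrow> (\<forall>i<n. p i)" for p and n :: nat
    by auto
  ultimately show ?thesis by simp
qed

lemma env_decidable_ex:
  assumes "env_computable A (Suc k) (\<lambda>e. of_bool (P (e 0) (\<lambda>j. e (Suc j))))"
    and "env_computable A k N"
  shows "env_computable A k (\<lambda>e. of_bool (\<exists>i<N e. P i e))"
proof -
  have "env_computable A k (\<lambda>e. of_bool (\<not> (\<forall>i<N e. \<not> P i e)))"
    using assms by (intro env_decidable_not env_decidable_all)
  then show ?thesis by simp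
qed

lemma env_computable_Least_decidable:
  assumes "env_computable A (Suc k) (\<lambda>e. of_bool (P (e 0) (\<lambda>j. e (Suc j))))"
    and ex: "\<And>e. \<exists>y. P y e"
  shows "env_computable A k (\<lambda>e. LEAST y. P y e)"
proof -
  have "env_computable A k (\<lambda>e. LEAST y. of_bool (\<not> P y e) = (0 :: nat))"
    using assms by (intro env_computable_Least env_decidable_not) auto
  then show ?thesis by simp
qed

lemma sum_of_bool_lessThan: "(\<Sum>i<n. of_bool (P i)) = card {i. i < n \<and> P i}" for n :: nat
  by (simp add: Int_def)

text \<open>The quotient \<open>a div b\<close> is the number of \<open>i\<close> with
  \<open>Suc i * b \<le> a\<close>, and all these \<open>i\<close> lie below
  \<open>a\<close>.\<close>

lemma env_computable_div:
  assumes "env_computable A k F" "env_computable A k G" and pos: "\<And>e. G e > 0"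
  shows "env_computable A k (\<lambda>e. F e div G e)"
proof -
  have "a div b = (\<Sum>i<a. of_bool (Suc i * b \<le> a))" if "b > 0" for a b :: nat
  proof -
    have "{i. i < a \<and> Suc i * b \<le> a} = {..<a div b}"
    proof -
      have "i < a div b \<longleftrightarrow> Suc i * b \<le> a" for i
        using that by (simp only: less_eq_div_iff_mult_less_eq flip: Suc_le_eq)
      then show ?thesis using div_le_dividend[of a b] by (auto intro: order_less_le_trans)
    qed
    then show ?thesis unfolding sum_of_bool_lessThan by simp
  qed
  then have "(\<lambda>e. F e div G e) = (\<lambda>e. \<Sum>i<F e. of_bool (Suc i * G e \<le> F e))"
    using pos by simp
  moreover have "env_computable A k (\<lambda>e. \<Sum>i<F e. of_bool (Suc i * G e \<le> F e))"
    using assms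
    by (intro env_computable_sum env_decidable_le env_computable_mult env_computable_Suc
        env_computable_var env_computable_shift) auto
  ultimately show ?thesis by simp
qed

lemma env_decidable_odd:
  assumes "env_computable A k F"
  shows "env_computable A k (\<lambda>e. of_bool (odd (F e)))"
proof -
  have "of_bool (odd n) = n - n div 2 * 2" for n :: nat
    by (simp add: minus_div_mult_eq_mod mod2_eq_if)
  then show ?thesis
    using assms
    by (simp only:) (intro env_computable_diff env_computable_mult env_computable_div
        env_computable_nat, auto)
qed

lemma env_computable_prod_encode:
  assumes "env_computable A k F" "env_computable A k G"
  shows "env_computable A k (\<lambda>e. prod_encode (F e, G e))"
  using assms unfolding prod_encode_def triangle_def prod.case
  by (intro env_computable_add env_computable_mult env_computable_div
        env_computable_nat env_computable_Suc) auto

lemmas env_computable_intros =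
  env_computable_0 env_computable_nat env_computable_var env_computable_Suc env_computable_add
  env_computable_diff env_computable_mult env_computable_power env_computable_sum
  env_computable_prod_encode env_decidable_odd
  env_decidable_le env_decidable_less env_decidable_eq env_decidable_not env_decidable_conj
  env_decidable_disj env_decidable_iff env_decidable_all env_decidable_ex

text \<open>Under \<open>no_oracle\<close> every query returns 0, so \<open>Zero\<close> can stand
  in for \<open>Query\<close>; the new program gives the same outputs with any oracle.\<close>

primrec drop_oracle :: "recf \<Rightarrow> recf" where
  "drop_oracle Zero = Zero"
| "drop_oracle Succ = Succ"
| "drop_oracle (Proj i) = Proj i"
| "drop_oracle Query = Zero"
| "drop_oracle (Comp f gs) = Comp (drop_oracle f) (map drop_oracle gs)"
| "drop_oracle (Prec f g) = Prec (drop_oracle f) (drop_oracle g)"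
| "drop_oracle (Mini f) = Mini (drop_oracle f)"

lemma run_drop_oracle: "run no_oracle e xs y \<Longrightarrow> run A (drop_oracle e) xs y"
proof (induction rule: run.induct)
  case (run_Comp xs gs ys f z)
  then show ?case
    by (auto intro!: run.run_Comp[where ys = ys] simp: list_all2_conv_all_nth)
qed (auto intro: run.intros)

lemma computable_in_oracle: "computable_in no_oracle k f \<Longrightarrow> computable_in A k f"
  unfolding computable_in_def by (blast intro: run_drop_oracle)

section \<open>The limit lemma\<close>

text \<open>At stage \<open>s\<close>, take the least \<open>x\<close> not yet refuted both as a
  witness for \<open>A n\<close> in the \<Sigma> form and as a witness against it in the \<Pi> form.
  Some \<open>x\<close> is never refuted, and refutations persist, so this choice settles on the
  least such \<open>x\<close>. The guess is whether its \<Sigma> half still survives.\<close>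

lemma Delta02_limit:
  assumes "Delta02 A"
  obtains ap where "decidable_in no_oracle 2 (\<lambda>xs. ap (xs ! 0) (xs ! 1))"
    and "\<And>n. \<exists>S. \<forall>s\<ge>S. ap n s = A n"
proof -
  from assms obtain R S where
    R: "decidable_in no_oracle 3 R" "\<And>n. A n \<longleftrightarrow> (\<exists>x. \<forall>y. R [n, x, y])" and
    S: "decidable_in no_oracle 3 S" "\<And>n. A n \<longleftrightarrow> (\<forall>x. \<exists>y. S [n, x, y])"
    unfolding Delta02_def Sigma02_def Pi02_def by blast
  define P where "P n s x \<longleftrightarrow> (\<forall>y<s. R [n, x, y]) \<or> (\<forall>y<s. \<not> S [n, x, y])" for n s x
  define w where "w n s = (LEAST x. P n s x)" for n s
  define ap where "ap n s \<longleftrightarrow> (\<forall>y<s. R [n, w n s, y])" for n s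
  have ex: "\<exists>x. \<forall>s. P n s x" for n
    using R(2)[of n] S(2)[of n] unfolding P_def by blast
  note app = env_computable_app3[OF R(1)[unfolded decidable_in_def]]
    env_computable_app3[OF S(1)[unfolded decidable_in_def]]
  have "env_computable no_oracle 2 (\<lambda>e. w (e 0) (e 1))"
    unfolding w_def
  proof (rule env_computable_Least_decidable)
    show "env_computable no_oracle (Suc 2) (\<lambda>e. of_bool (P (e (Suc 0)) (e (Suc 1)) (e 0)))"
      unfolding P_def by (intro env_computable_intros app) auto
  qed (use ex in blast)
  then have "env_computable no_oracle 2 (\<lambda>e. of_bool (ap (e 0) (e 1)))"
    unfolding ap_def by (intro env_computable_intros app env_computable_shift) auto
  then have 1: "decidable_in no_oracle 2 (\<lambda>xs. ap (xs ! 0) (xs ! 1))"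
    by (simp add: env_computable_def decidable_in_def)
  have 2: "\<exists>N. \<forall>s\<ge>N. ap n s = A n" for n
  proof -
    define m where "m = (LEAST x. \<forall>s. P n s x)"
    have m: "P n s m" for s
      using LeastI_ex[OF ex[of n]] by (simp add: m_def)
    have "\<forall>x<m. \<exists>s. \<not> P n s x"
      using not_less_Least unfolding m_def by blast
    then obtain g where g: "\<And>x. x < m \<Longrightarrow> \<not> P n (g x) x" by metis
    have mono: "P n t x" if "P n s x" "t \<le> s" for s t x
      using that unfolding P_def by (meson order_less_le_trans)
    have w: "w n s = m" if "\<And>x. x < m \<Longrightarrow> g x \<le> s" for s
      unfolding w_def using g m mono that by (intro Least_equality) (blast, meson not_less)
    \<comment> \<open>The sum bounds all the refutation stages \<open>g x\<close> of the candidates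
      below \<open>m\<close> at once.\<close>
    have bd: "x < m \<Longrightarrow> g x \<le> (\<Sum>x<m. g x)" for x
      by (intro member_le_sum) auto
    have w_eq: "w n s = m" if "(\<Sum>x<m. g x) \<le> s" for s
      using order_trans[OF bd that] by (rule w)
    show ?thesis
    proof (cases "\<forall>y. R [n, m, y]")
      case True
      then have "A n" using R(2) by blast
      with True w_eq show ?thesis unfolding ap_def by auto
    next
      case False
      then obtain y where y: "\<not> R [n, m, y]" by blast
      \<comment> \<open>The stage \<open>Suc (y + z)\<close> exceeds both \<open>y\<close> and
        \<open>z\<close>: there the first half of \<open>P\<close> is refuted by \<open>y\<close>,
        so the second half must hold at \<open>z\<close>.\<close>
      have "\<not> S [n, m, z]" for z
        using m[of "Suc (y + z)"] y unfolding P_def by auto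
      then have "\<not> A n" using S(2) by blast
      moreover have "\<not> ap n s" if "s \<ge> Suc y + (\<Sum>x<m. g x)" for s
      proof -
        have "w n s = m" "y < s" using that w_eq[of s] by auto
        then show ?thesis using y by (auto simp: ap_def)
      qed
      ultimately show ?thesis by blast
    qed
  qed
  from 1 2 show ?thesis by (rule that)
qed

section \<open>Strings as numbers\<close>

definition prefix_of :: "(nat \<Rightarrow> bool) \<Rightarrow> nat \<Rightarrow> bool list" where
  "prefix_of X n = map X [0..<n]"

lemma length_prefix_of [simp]: "length (prefix_of X n) = n"
  by (simp add: prefix_of_def)

lemma nth_prefix_of [simp]: "i < n \<Longrightarrow> prefix_of X n ! i = X i"
  by (simp add: prefix_of_def)

lemma prefix_of_eq_iff: "prefix_of X n = prefix_of Y n \<longleftrightarrow> (\<forall>i<n. X i = Y i)"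
  by (auto simp: prefix_of_def)

lemma mem_cylinder_iff: "X \<in> cylinder \<sigma> \<longleftrightarrow> prefix_of X (length \<sigma>) = \<sigma>"
  by (auto simp: cylinder_def list_eq_iff_nth_eq)

lemma mem_cylinder_prefix_of [simp]: "X \<in> cylinder (prefix_of X n)"
  by (simp add: cylinder_def)

text \<open>This is binary digit \<open>i\<close> of \<open>Suc c\<close>, in line with the digits
  used by \<open>str_code\<close>.\<close>

definition string_bit :: "nat \<Rightarrow> nat \<Rightarrow> bool" where
  "string_bit c i \<longleftrightarrow> odd (Suc c div 2 ^ i)"

text \<open>This is the integer part of the binary logarithm of \<open>Suc c\<close>, as a bounded
  count so that the closure rules apply. The range \<open>i < c\<close> loses nothing, since
  \<open>2 ^ Suc i \<le> Suc c\<close> forces \<open>i < c\<close>.\<close>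

definition string_length :: "nat \<Rightarrow> nat" where
  "string_length c = (\<Sum>i<c. of_bool (2 ^ Suc i \<le> Suc c))"

lemma Suc_str_code_Cons: "Suc (str_code (b # \<sigma>)) = 2 * Suc (str_code \<sigma>) + of_bool b"
  by simp

lemma str_code_bounds: "2 ^ length \<sigma> \<le> Suc (str_code \<sigma>)" "Suc (str_code \<sigma>) < 2 ^ Suc (length \<sigma>)"
  by (induction \<sigma>) auto

lemma string_length_str_code [simp]: "string_length (str_code \<sigma>) = length \<sigma>"
proof -
  have "{i. i < str_code \<sigma> \<and> 2 ^ Suc i \<le> Suc (str_code \<sigma>)} = {..<length \<sigma>}"
  proof (intro equalityI subsetI)
    fix i assume "i \<in> {i. i < str_code \<sigma> \<and> 2 ^ Suc i \<le> Suc (str_code \<sigma>)}"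
    then have "2 ^ Suc i < (2 :: nat) ^ Suc (length \<sigma>)"
      using str_code_bounds(2)[of \<sigma>] by (auto simp only: mem_Collect_eq)
    then show "i \<in> {..<length \<sigma>}" by simp
  next
    fix i assume i: "i \<in> {..<length \<sigma>}"
    then have "2 ^ Suc i \<le> (2 :: nat) ^ length \<sigma>" by (intro power_increasing) auto
    moreover have "length \<sigma> < 2 ^ length \<sigma>" by simp
    ultimately show "i \<in> {i. i < str_code \<sigma> \<and> 2 ^ Suc i \<le> Suc (str_code \<sigma>)}"
      using str_code_bounds(1)[of \<sigma>] i unfolding mem_Collect_eq lessThan_iff by linarith
  qed
  then show ?thesis
    unfolding string_length_def sum_of_bool_lessThan by simp
qed

lemma string_bit_str_code: "i < length \<sigma> \<Longrightarrow> string_bit (str_code \<sigma>) i = \<sigma> ! i"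
proof (induction \<sigma> arbitrary: i)
  case (Cons b \<sigma>)
  show ?case
  proof (cases i)
    case (Suc j)
    have "(2 * Suc (str_code \<sigma>) + of_bool b) div 2 = Suc (str_code \<sigma>)" by simp
    with Suc Cons show ?thesis
      unfolding string_bit_def Suc_str_code_Cons by (simp only: power_Suc div_mult2_eq) simp
  qed (simp add: string_bit_def)
qed simp

text \<open>Unrolling the recursion of \<open>str_code\<close> gives a sum of digits, by which a
  code can be computed from the bits of its string.\<close>

lemma str_code_eq_sum: "Suc (str_code \<sigma>) = 2 ^ length \<sigma> + (\<Sum>i<length \<sigma>. of_bool (\<sigma> ! i) * 2 ^ i)"
proof (induction \<sigma>)
  case (Cons b \<sigma>)
  have "(\<Sum>i<length \<sigma>. of_bool (\<sigma> ! i) * 2 ^ Suc i) = 2 * (\<Sum>i<length \<sigma>. of_bool (\<sigma> ! i) * (2 :: nat) ^ i)"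
    unfolding sum_distrib_left by (intro sum.cong) auto
  then show ?case
    unfolding Suc_str_code_Cons Cons.IH list.size(4) add_0_right add_Suc_right sum.lessThan_Suc_shift
    by simp
qed simp

lemma env_computable_string_length:
  "env_computable A k F \<Longrightarrow> env_computable A k (\<lambda>e. string_length (F e))"
  unfolding string_length_def
  by (intro env_computable_intros env_computable_shift) auto

lemma env_decidable_string_bit:
  "env_computable A k F \<Longrightarrow> env_computable A k G \<Longrightarrow>
    env_computable A k (\<lambda>e. of_bool (string_bit (F e) (G e)))"
  unfolding string_bit_def
  by (intro env_computable_intros env_computable_div) auto


section \<open>The measure\<close>

locale limit_approximation =
  fixes A :: "nat \<Rightarrow> bool" and ap :: "nat \<Rightarrow> nat \<Rightarrow> bool"
  assumes decidable_ap: "decidable_in no_oracle 2 (\<lambda>xs. ap (xs ! 0) (xs ! 1))"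
    and ap_converges: "\<And>n. \<exists>S. \<forall>s\<ge>S. ap n s = A n"
begin

text \<open>The bound \<open>n \<le> s\<close> makes \<open>agreement X\<close> depend on a finite part of \<open>X\<close> only, unless \<open>X = A\<close>.\<close>

definition agreement :: "(nat \<Rightarrow> bool) \<Rightarrow> nat \<Rightarrow> bool" where
  "agreement X k \<longleftrightarrow> (case prod_decode k of (n, s) \<Rightarrow> n \<le> s \<and> (\<forall>i\<le>n. X i = ap i s))"

text \<open>The values of \<open>nth \<tau>\<close> beyond the end of \<open>\<tau>\<close> are
  unspecified but harmless: by \<open>agreement_cong\<close> the bits kept here read only positions
  below \<open>length \<tau>\<close>.\<close>

definition agreement_string :: "bool list \<Rightarrow> bool list" where
  "agreement_string \<tau> = prefix_of (agreement (nth \<tau>)) (length \<tau>)"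

definition agreement_measure :: "(nat \<Rightarrow> bool) measure" where
  "agreement_measure = distr cantor_lebesgue cantor_space agreement"

lemma agreement_prod_encode [simp]:
  "agreement X (prod_encode (n, s)) \<longleftrightarrow> n \<le> s \<and> (\<forall>i\<le>n. X i = ap i s)"
  by (simp add: agreement_def)

text \<open>A pair code is at least its first component, so bit \<open>k\<close> of the image reads
  no input position above \<open>k\<close>.\<close>

lemma agreement_cong:
  assumes "\<And>i. i \<le> k \<Longrightarrow> X i = Y i"
  shows "agreement X k = agreement Y k"
proof -
  obtain n s where k: "k = prod_encode (n, s)" by (metis prod_decode_inverse surj_pair)
  have "i \<le> n \<Longrightarrow> X i = Y i" for i
    using le_prod_encode_1[of n s] by (intro assms) (simp add: k)
  then show ?thesis by (auto simp: k)
qed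

lemma length_agreement_string [simp]: "length (agreement_string \<tau>) = length \<tau>"
  by (simp add: agreement_string_def)

lemma agreement_string_prefix_of: "agreement_string (prefix_of X n) = prefix_of (agreement X) n"
  unfolding agreement_string_def length_prefix_of prefix_of_eq_iff
  by (auto intro!: agreement_cong)

lemma agreement_mem_cylinder_iff:
  "agreement X \<in> cylinder \<sigma> \<longleftrightarrow> agreement_string (prefix_of X (length \<sigma>)) = \<sigma>"
  by (simp add: mem_cylinder_iff agreement_string_prefix_of)

text \<open>The map commutes with taking prefixes, so membership of the image in a cylinder is
  settled by an input prefix of the same length. Both the computation of the measure and the
  pullback of tests rest on this.\<close>

lemma vimage_agreement_cylinder:
  "agreement -` cylinder \<sigma> = (\<Union>\<tau>\<in>{\<tau>. agreement_string \<tau> = \<sigma>}. cylinder \<tau>)"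
proof (intro equalityI subsetI)
  fix X assume "X \<in> agreement -` cylinder \<sigma>"
  then show "X \<in> (\<Union>\<tau>\<in>{\<tau>. agreement_string \<tau> = \<sigma>}. cylinder \<tau>)"
    by (auto simp: agreement_mem_cylinder_iff intro!: exI[of _ "prefix_of X (length \<sigma>)"])
next
  fix X assume "X \<in> (\<Union>\<tau>\<in>{\<tau>. agreement_string \<tau> = \<sigma>}. cylinder \<tau>)"
  then show "X \<in> agreement -` cylinder \<sigma>"
    by (auto simp: agreement_mem_cylinder_iff) (simp add: mem_cylinder_iff)
qed

lemma agreement_measurable: "agreement \<in> measurable cantor_lebesgue cantor_space"
proof -
  have "(\<lambda>X. agreement X k) \<in> measurable cantor_space (count_space UNIV)" for k
  proof -
    obtain n s where "k = prod_encode (n, s)" by (metis prod_decode_inverse surj_pair)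
    then show ?thesis
      unfolding cantor_space_def by simp measurable
  qed
  then have "agreement \<in> measurable cantor_space cantor_space"
    by (subst (2) cantor_space_def) (intro measurable_PiM_single', auto simp: space_PiM)
  then show ?thesis
    using cantor_prob_lebesgue by (simp add: cantor_prob_def cong: measurable_cong_sets)
qed

lemma cantor_prob_agreement_measure: "cantor_prob agreement_measure"
  using cantor_prob_lebesgue prob_space.prob_space_distr[OF _ agreement_measurable]
  unfolding cantor_prob_def agreement_measure_def by auto

lemma space_lebesgue: "space cantor_lebesgue = UNIV"
  by (simp add: cantor_lebesgue_def space_PiM)

lemma measure_agreement_measure:
  "B \<in> sets cantor_space \<Longrightarrow> measure agreement_measure B = measure cantor_lebesgue (agreement -` B)"
  unfolding agreement_measure_def
  by (subst measure_distr[OF agreement_measurable]) (auto simp: space_lebesgue)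

lemma cylinder_sets_lebesgue: "cylinder \<sigma> \<in> sets cantor_lebesgue"
  using cylinder_measurable cantor_prob_lebesgue by (simp add: cantor_prob_def)

lemma vimage_agreement_sets: "B \<in> sets cantor_space \<Longrightarrow> agreement -` B \<in> sets cantor_lebesgue"
  using measurable_sets[OF agreement_measurable] by (simp add: space_lebesgue)

section \<open>Computability of the measure\<close>

definition preimages :: "bool list \<Rightarrow> bool list set" where
  "preimages \<sigma> = {\<tau>. agreement_string \<tau> = \<sigma>}"

lemma finite_preimages: "finite (preimages \<sigma>)"
proof (rule finite_subset)
  show "preimages \<sigma> \<subseteq> {\<tau>. set \<tau> \<subseteq> UNIV \<and> length \<tau> = length \<sigma>}"
    by (auto simp: preimages_def)
qed (intro finite_lists_length_eq finite)

text \<open>The inverse image of the cylinder is a union of cylinders over distinct strings of one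
  length, hence disjoint and of equal Lebesgue measure. The value is an exact dyadic
  rational.\<close>

lemma measure_agreement_measure_cylinder:
  "measure agreement_measure (cylinder \<sigma>) = card (preimages \<sigma>) / 2 ^ length \<sigma>"
proof -
  interpret prob_space cantor_lebesgue
    using cantor_prob_lebesgue by (simp add: cantor_prob_def)
  have "measure agreement_measure (cylinder \<sigma>) = measure cantor_lebesgue (\<Union>\<tau>\<in>preimages \<sigma>. cylinder \<tau>)"
    by (simp add: measure_agreement_measure cylinder_measurable vimage_agreement_cylinder preimages_def)
  also have "\<dots> = (\<Sum>\<tau>\<in>preimages \<sigma>. measure cantor_lebesgue (cylinder \<tau>))"
    using finite_preimages cylinder_sets_lebesgue
    by (intro finite_measure_finite_Union)
      (auto simp: disjoint_family_on_def mem_cylinder_iff preimages_def, metis length_agreement_string)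
  also have "\<dots> = (\<Sum>\<tau>\<in>preimages \<sigma>. (1/2) ^ length \<sigma>)"
    by (intro sum.cong) (auto simp: measure_lebesgue_cylinder preimages_def)
  finally show ?thesis by (simp add: power_divide)
qed

text \<open>The effect of \<open>agreement_string\<close> on codes; the final subtraction undoes the
  \<open>Suc\<close> in \<open>str_code_eq_sum\<close>.\<close>

definition agreement_code :: "nat \<Rightarrow> nat" where
  "agreement_code c = 2 ^ string_length c
    + (\<Sum>k<string_length c. of_bool (agreement (string_bit c) k) * 2 ^ k) - 1"

lemma agreement_code_str_code: "agreement_code (str_code \<tau>) = str_code (agreement_string \<tau>)"
proof -
  have "agreement (string_bit (str_code \<tau>)) k = agreement_string \<tau> ! k" if "k < length \<tau>" for k
    using that by (auto simp: agreement_string_def string_bit_str_code intro!: agreement_cong)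
  then have "agreement_code (str_code \<tau>) = 2 ^ length (agreement_string \<tau>)
    + (\<Sum>k<length (agreement_string \<tau>). of_bool (agreement_string \<tau> ! k) * 2 ^ k) - 1"
    by (simp add: agreement_code_def)
  also have "\<dots> = str_code (agreement_string \<tau>)"
    unfolding str_code_eq_sum[symmetric] by simp
  finally show ?thesis .
qed

lemma env_decidable_ap:
  "env_computable B k F \<Longrightarrow> env_computable B k G \<Longrightarrow>
    env_computable B k (\<lambda>e. of_bool (ap (F e) (G e)))"
  using env_computable_app2[OF computable_in_oracle[OF decidable_ap[unfolded decidable_in_def]]]
  by simp

lemma env_computable_agreement_code:
  assumes "env_computable B k F"
  shows "env_computable B k (\<lambda>e. agreement_code (F e))"
proof -
  \<comment> \<open>Decoding the pair becomes a search below \<open>Suc k\<close>, since neither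
    component exceeds the code; only bounded quantifiers remain.\<close>
  have "agreement X k \<longleftrightarrow>
      (\<exists>n<Suc k. \<exists>s<Suc k. k = prod_encode (n, s) \<and> n \<le> s \<and> (\<forall>i<Suc n. X i = ap i s))" for X k
  proof -
    obtain n s where k: "k = prod_encode (n, s)" by (metis prod_decode_inverse surj_pair)
    then show ?thesis
      using le_prod_encode_1[of n s] le_prod_encode_2[of s n] by (auto simp: less_Suc_eq_le)
  qed
  then show ?thesis
    unfolding agreement_code_def using assms
    by (simp only:) (intro env_computable_intros env_computable_string_length env_decidable_string_bit
        env_decidable_ap env_computable_shift, auto)
qed

text \<open>A preimage \<open>\<tau>\<close> has the same length as \<open>\<sigma>\<close>, so
  \<open>str_code_bounds\<close> puts its code below \<open>2 * Suc (str_code \<sigma>)\<close>;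
  counting up to there misses none.\<close>

lemma card_preimages:
  "card (preimages \<sigma>) = (\<Sum>c<2 * Suc (str_code \<sigma>). of_bool (agreement_code c = str_code \<sigma>))"
proof -
  have "str_code ` preimages \<sigma> = {c. c < 2 * Suc (str_code \<sigma>) \<and> agreement_code c = str_code \<sigma>}"
  proof (intro equalityI subsetI)
    fix c assume "c \<in> str_code ` preimages \<sigma>"
    then obtain \<tau> where \<tau>: "c = str_code \<tau>" "agreement_string \<tau> = \<sigma>" by (auto simp: preimages_def)
    have "length \<tau> = length \<sigma>" using \<tau>(2) by auto
    then show "c \<in> {c. c < 2 * Suc (str_code \<sigma>) \<and> agreement_code c = str_code \<sigma>}"
      using str_code_bounds(2)[of \<tau>] str_code_bounds(1)[of \<sigma>] \<tau>
      by (auto simp: agreement_code_str_code)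
  next
    fix c assume "c \<in> {c. c < 2 * Suc (str_code \<sigma>) \<and> agreement_code c = str_code \<sigma>}"
    moreover obtain \<tau> where "c = str_code \<tau>"
      using bij_str_code by (metis bij_pointE)
    ultimately show "c \<in> str_code ` preimages \<sigma>"
      using bij_is_inj[OF bij_str_code]
      by (auto simp: agreement_code_str_code preimages_def inj_eq)
  qed
  moreover have "card (str_code ` preimages \<sigma>) = card (preimages \<sigma>)"
    using bij_is_inj[OF bij_str_code] by (intro card_image) (auto intro: inj_on_subset)
  ultimately show ?thesis unfolding sum_of_bool_lessThan by simp
qed

lemma computable_agreement_measure: "computable_measure agreement_measure"
  unfolding computable_measure_def computable_dyadic_def
proof (intro exI conjI allI)
  \<comment> \<open>The factor 2 arises because \<open>int_encode\<close> sends a nonnegative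
    integer \<open>m\<close> to \<open>2 * m\<close>. The approximation is exact, so the precision
    \<open>i\<close> is ignored.\<close>
  let ?num = "\<lambda>xs :: nat list. 2 * (\<Sum>c<2 * Suc (xs ! 0). of_bool (agreement_code c = xs ! 0)) :: nat"
  have "env_computable no_oracle 2
      (\<lambda>e. 2 * (\<Sum>c<2 * Suc (e 0). of_bool (agreement_code c = e 0)))"
    by (intro env_computable_intros env_computable_agreement_code) auto
  then show "computable_in no_oracle 2 ?num" by (simp add: env_computable_def)
  have "env_computable no_oracle 2 (\<lambda>e. string_length (e 0))"
    by (intro env_computable_string_length env_computable_var) auto
  then show "computable_in no_oracle 2 (\<lambda>xs. string_length (xs ! 0))" by (simp add: env_computable_def)
  fix \<sigma> i
  show "measure agreement_measure (cylinder \<sigma>)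
      = of_int (int_decode (?num [str_code \<sigma>, i])) / 2 ^ string_length ([str_code \<sigma>, i] ! 0)"
    unfolding measure_agreement_measure_cylinder card_preimages
    by (simp add: int_decode_def sum_decode_def)
  show "\<bar>measure agreement_measure (cylinder \<sigma>) - measure agreement_measure (cylinder \<sigma>)\<bar> \<le> (1/2) ^ i"
    by simp
qed

section \<open>Atoms\<close>

lemma lebesgue_singleton: "measure cantor_lebesgue {X} = 0"
proof -
  interpret prob_space cantor_lebesgue
    using cantor_prob_lebesgue by (simp add: cantor_prob_def)
  have "measure cantor_lebesgue {X} \<le> (1/2) ^ n" for n
    using finite_measure_mono[of "{X}" "cylinder (prefix_of X n)"] cylinder_sets_lebesgue
    by (simp add: measure_lebesgue_cylinder)
  then have "measure cantor_lebesgue {X} \<le> 0"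
    by (intro tendsto_lowerbound[OF LIMSEQ_power_zero[of "1/2 :: real"]]) auto
  then show ?thesis by (simp add: measure_le_0_iff)
qed

text \<open>Summing the convergence stages of all \<open>i \<le> n\<close> gives a common one;
  adding \<open>n\<close> secures the \<open>n \<le> s\<close> that \<open>agreement\<close>
  demands.\<close>

lemma ap_agrees: "\<exists>s\<ge>n. \<forall>i\<le>n. ap i s = A i"
proof -
  from ap_converges obtain S where "\<And>n s. s \<ge> S n \<Longrightarrow> ap n s = A n" by metis
  moreover have "S i \<le> (\<Sum>i\<le>n. S i)" if "i \<le> n" for i
    using that by (intro member_le_sum) auto
  ultimately show ?thesis
    by (intro exI[of _ "n + (\<Sum>i\<le>n. S i)"]) (fastforce intro: trans_le_add2)
qed

text \<open>At a stage \<open>s \<ge> n\<close> that is correct up to \<open>n\<close>, the image of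
  \<open>A\<close> has a true bit, and a true bit there forces \<open>X\<close> to match
  \<open>A\<close> up to \<open>n\<close>.\<close>

lemma agreement_eq_agreement_A_iff: "agreement X = agreement A \<longleftrightarrow> X = A"
proof
  assume eq: "agreement X = agreement A"
  show "X = A"
  proof
    fix n
    from ap_agrees obtain s where "n \<le> s" "\<forall>i\<le>n. ap i s = A i" by blast
    then show "X n = A n"
      using fun_cong[OF eq, of "prod_encode (n, s)"] by auto
  qed
qed simp

lemma agreement_mem_Atoms:
  assumes "X \<noteq> A"
  shows "agreement X \<in> Atoms agreement_measure"
proof -
  interpret prob_space cantor_lebesgue
    using cantor_prob_lebesgue by (simp add: cantor_prob_def)
  from assms obtain d where d: "X d \<noteq> A d" by blast
  from ap_converges obtain S where S: "\<And>s. s \<ge> S \<Longrightarrow> ap d s = A d" by blast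
  \<comment> \<open>If \<open>n \<ge> d\<close> and \<open>s \<ge> S\<close>, both bits are false
    because of the disagreement at \<open>d\<close>. Otherwise \<open>n < d\<close> or
    \<open>s < S\<close>, and with \<open>n \<le> s\<close> every position read lies below
    \<open>Suc (d + S)\<close>.\<close>
  have "agreement Y = agreement X" if Y: "\<And>i. i < Suc (d + S) \<Longrightarrow> Y i = X i" for Y
  proof
    fix k
    obtain n s where k: "k = prod_encode (n, s)" by (metis prod_decode_inverse surj_pair)
    show "agreement Y k = agreement X k"
    proof (cases "n \<ge> d \<and> s \<ge> S")
      case True
      then show ?thesis using d S[of s] Y[of d] by (auto simp: k)
    next
      case False
      then have "n \<le> s \<Longrightarrow> i \<le> n \<Longrightarrow> Y i = X i" for i
        by (intro Y) auto
      then show ?thesis by (auto simp: k)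
    qed
  qed
  moreover have "Y i = X i" if "Y \<in> cylinder (prefix_of X (Suc (d + S)))" "i < Suc (d + S)" for Y i
    using that by (simp add: cylinder_def)
  ultimately have "cylinder (prefix_of X (Suc (d + S))) \<subseteq> agreement -` {agreement X}"
    by blast
  then have "measure cantor_lebesgue (cylinder (prefix_of X (Suc (d + S)))) \<le>
      measure cantor_lebesgue (agreement -` {agreement X})"
    using singleton_measurable by (intro finite_measure_mono vimage_agreement_sets)
  moreover have "measure cantor_lebesgue (cylinder (prefix_of X (Suc (d + S)))) > 0"
    by (simp add: measure_lebesgue_cylinder)
  ultimately show ?thesis
    using singleton_measurable by (simp add: Atoms_def measure_agreement_measure)
qed

lemma agreement_A_notin_Atoms: "agreement A \<notin> Atoms agreement_measure"
proof -
  have "agreement -` {agreement A} = {A}"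
    by (auto simp: agreement_eq_agreement_A_iff)
  then show ?thesis
    using singleton_measurable by (simp add: Atoms_def measure_agreement_measure lebesgue_singleton)
qed

text \<open>Every sequence except \<open>A\<close> is mapped to an atom, and \<open>{A}\<close> is a
  Lebesgue null set.\<close>

lemma trivial_agreement_measure: "trivial_measure agreement_measure"
proof -
  interpret prob_space cantor_lebesgue
    using cantor_prob_lebesgue by (simp add: cantor_prob_def)
  have Atoms: "Atoms agreement_measure \<in> sets cantor_space"
    using Atoms_measurable[OF cantor_prob_agreement_measure] cantor_prob_agreement_measure
    by (simp add: cantor_prob_def)
  have "agreement -` Atoms agreement_measure = space cantor_lebesgue - {A}"
    using agreement_mem_Atoms agreement_A_notin_Atoms by (auto simp: space_lebesgue)
  moreover have "{A} \<in> events"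
    using singleton_measurable cantor_prob_lebesgue by (simp add: cantor_prob_def)
  ultimately show ?thesis
    by (simp add: trivial_measure_def measure_agreement_measure[OF Atoms] prob_compl lebesgue_singleton)
qed

section \<open>Randomness\<close>

text \<open>Pulling a test back preserves its measure bounds, as the measure is an image measure,
  and its effectiveness, as \<open>agreement_code\<close> is computable.\<close>

lemma agreement_mem_MLR:
  assumes "X \<in> MLR cantor_lebesgue"
  shows "agreement X \<in> MLR agreement_measure"
  unfolding MLR_def MLR_in_def
proof (intro CollectI allI impI)
  fix U assume U: "martin_loef_test agreement_measure no_oracle U"
  then obtain R where R: "decidable_in no_oracle 3 R"
    and U_eq: "\<And>i. U i = (\<Union>\<sigma>\<in>{\<sigma>. \<exists>s. R [i, str_code \<sigma>, s]}. cylinder \<sigma>)"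
    unfolding martin_loef_test_def uniformly_Sigma01_in_def by auto
  define V where "V i = agreement -` U i" for i
  define R' where "R' xs = R [xs ! 0, agreement_code (xs ! 1), xs ! 2]" for xs
  have "env_computable no_oracle 3 (\<lambda>e. of_bool (R [e 0, agreement_code (e 1), e 2]))"
    by (intro env_computable_app3[OF R[unfolded decidable_in_def]] env_computable_intros
        env_computable_agreement_code) auto
  then have "decidable_in no_oracle 3 R'"
    by (simp add: env_computable_def decidable_in_def R'_def)
  moreover have "V i = (\<Union>\<tau>\<in>{\<tau>. \<exists>s. R' [i, str_code \<tau>, s]}. cylinder \<tau>)" for i
  proof -
    have "V i = (\<Union>\<sigma>\<in>{\<sigma>. \<exists>s. R [i, str_code \<sigma>, s]}. agreement -` cylinder \<sigma>)"
      by (auto simp: V_def U_eq)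
    also have "\<dots> = (\<Union>\<tau>\<in>{\<tau>. \<exists>s. R' [i, str_code \<tau>, s]}. cylinder \<tau>)"
      by (auto simp: vimage_agreement_cylinder R'_def agreement_code_str_code)
    finally show ?thesis .
  qed
  moreover have "measure cantor_lebesgue (V i) \<le> (1/2) ^ i" for i
  proof -
    have "U i \<in> sets cantor_space"
      using uniformly_Sigma01_in_measurable[OF cantor_prob_agreement_measure] U
        cantor_prob_agreement_measure by (auto simp: martin_loef_test_def cantor_prob_def)
    with U show ?thesis
      by (auto simp: V_def martin_loef_test_def simp flip: measure_agreement_measure)
  qed
  ultimately have "martin_loef_test cantor_lebesgue no_oracle V"
    unfolding martin_loef_test_def uniformly_Sigma01_in_def by blast
  with assms have "X \<notin> (\<Inter>i. V i)" unfolding MLR_def MLR_in_def by blast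
  then show "agreement X \<notin> (\<Inter>i. U i)" by (auto simp: V_def)
qed

text \<open>Koenig's lemma: a string is kept if infinitely many of the \<open>\<tau>\<close> extend it.\<close>

lemma agreement_range:
  assumes "\<And>n. \<exists>\<tau>. agreement_string \<tau> = prefix_of Y n"
  shows "Y \<in> range agreement"
proof -
  define T where "T = {\<tau>. agreement_string \<tau> = prefix_of Y (length \<tau>)}"
  define live where "live \<sigma> \<longleftrightarrow> (\<forall>N. \<exists>\<tau>\<in>T. length \<tau> \<ge> N \<and> take (length \<sigma>) \<tau> = \<sigma>)" for \<sigma>
  have "live []"
    unfolding live_def
  proof
    fix N
    obtain \<tau> where \<tau>: "agreement_string \<tau> = prefix_of Y N" using assms by blast
    from arg_cong[OF this, of length] have "length \<tau> = N" by simp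
    with \<tau> show "\<exists>\<tau>\<in>T. length \<tau> \<ge> N \<and> take (length []) \<tau> = []"
      by (intro bexI[of _ \<tau>]) (auto simp: T_def)
  qed
  have step: "\<exists>b. live (\<sigma> @ [b])" if "live \<sigma>" for \<sigma>
  proof (rule ccontr)
    assume "\<not> ?thesis"
    then obtain N where N: "\<And>b \<tau>. \<tau> \<in> T \<Longrightarrow> length \<tau> \<ge> N b \<Longrightarrow> take (Suc (length \<sigma>)) \<tau> \<noteq> \<sigma> @ [b]"
      unfolding live_def by simp metis
    \<comment> \<open>The length passes both failure bounds and leaves a bit after
      \<open>\<sigma>\<close>; whichever bit it is, its bound is contradicted.\<close>
    obtain \<tau> where "\<tau> \<in> T" "length \<tau> \<ge> N True + N False + Suc (length \<sigma>)" "take (length \<sigma>) \<tau> = \<sigma>"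
      using that \<open>live \<sigma>\<close> unfolding live_def by blast
    then show False
      using N[of \<tau> "\<tau> ! length \<sigma>"] by (cases "\<tau> ! length \<sigma>") (auto simp: take_Suc_conv_app_nth)
  qed
  then obtain b where b: "\<And>\<sigma>. live \<sigma> \<Longrightarrow> live (\<sigma> @ [b \<sigma>])" by metis
  define p where "p = rec_nat [] (\<lambda>_ \<sigma>. \<sigma> @ [b \<sigma>])"
  define X where "X n = b (p n)" for n
  have p: "p n = prefix_of X n" "live (p n)" for n
    by (induction n) (use \<open>live []\<close> b in \<open>auto simp: p_def X_def prefix_of_def\<close>)
  have "agreement X = Y"
  proof
    fix k
    \<comment> \<open>The string may differ from \<open>X\<close> after \<open>Suc k\<close> bits,
      but these bits already determine bit \<open>k\<close> of the image.\<close>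
    from p(2)[of "Suc k"] obtain \<tau> where \<tau>: "\<tau> \<in> T" "length \<tau> \<ge> Suc k" "take (Suc k) \<tau> = prefix_of X (Suc k)"
      unfolding live_def p(1) by auto
    have "\<tau> ! i = X i" if "i \<le> k" for i
      using that \<tau>(2,3) by (metis le_imp_less_Suc nth_prefix_of nth_take)
    then have "agreement X k = agreement (nth \<tau>) k"
      by (intro agreement_cong) auto
    also have "\<dots> = Y k"
      using \<tau>(1,2) by (simp add: T_def agreement_string_def prefix_of_eq_iff)
    finally show "agreement X k = Y k" .
  qed
  then show ?thesis by blast
qed

text \<open>
  The first disjunct captures \<open>agreement A\<close>: a sequence \<open>agreement X\<close> certifying agreement with a
  correct approximation forces \<open>X\<close> to extend \<open>A\<close> up to \<open>i\<close>. The second one captures every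
  sequence outside the range.
\<close>

definition capture :: "nat \<Rightarrow> bool list \<Rightarrow> nat \<Rightarrow> bool" where
  "capture i \<sigma> s \<longleftrightarrow>
    (prod_encode (i, s) < length \<sigma> \<and> \<sigma> ! prod_encode (i, s) \<and> (\<forall>j\<le>i. ap j s = A j))
    \<or> preimages \<sigma> = {}"

text \<open>Comparing \<open>ap j s\<close> with \<open>A j\<close> takes oracle queries, and
  emptiness of \<open>preimages \<sigma>\<close> is decided by counting. Strings without preimages
  carry no measure, and the rest of level \<open>i\<close> pulls back into one cylinder of length
  \<open>Suc i\<close>.\<close>

lemma capture_test:
  "martin_loef_test agreement_measure A (\<lambda>i. \<Union>\<sigma>\<in>{\<sigma>. \<exists>s. capture i \<sigma> s}. cylinder \<sigma>)"
    (is "martin_loef_test _ _ ?U")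
proof -
  interpret prob_space cantor_lebesgue
    using cantor_prob_lebesgue by (simp add: cantor_prob_def)
  define R where "R i c s \<longleftrightarrow> prod_encode (i, s) < string_length c \<and> string_bit c (prod_encode (i, s)) \<and>
      (\<forall>j<Suc i. ap j s = A j) \<or> (\<Sum>d<2 * Suc c. of_bool (agreement_code d = c)) = (0 :: nat)" for i c s
  have R: "R i (str_code \<sigma>) s \<longleftrightarrow> capture i \<sigma> s" for i \<sigma> s
    unfolding R_def capture_def card_preimages[symmetric]
    by (auto simp: string_bit_str_code finite_preimages less_Suc_eq_le)
  have "env_computable A 3 (\<lambda>e. of_bool (R (e 0) (e 1) (e 2)))"
    unfolding R_def
    by (intro env_computable_intros env_computable_oracle env_decidable_ap env_decidable_string_bit
        env_computable_string_length env_computable_agreement_code) auto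
  then have "decidable_in A 3 (\<lambda>xs. R (xs ! 0) (xs ! 1) (xs ! 2))"
    by (simp add: env_computable_def decidable_in_def)
  then have Sigma: "uniformly_Sigma01_in A ?U"
    unfolding uniformly_Sigma01_in_def
    by (intro exI[of _ "\<lambda>xs. R (xs ! 0) (xs ! 1) (xs ! 2)"]) (auto simp: R)
  have "measure agreement_measure (?U i) \<le> (1/2) ^ i" for i
  proof -
    have U: "?U i \<in> sets cantor_space"
      using uniformly_Sigma01_in_measurable[OF cantor_prob_agreement_measure Sigma]
        cantor_prob_agreement_measure by (simp add: cantor_prob_def)
    have "agreement -` ?U i \<subseteq> cylinder (prefix_of A (Suc i))"
    proof
      fix X assume "X \<in> agreement -` ?U i"
      then obtain \<sigma> s where \<sigma>: "capture i \<sigma> s" "agreement X \<in> cylinder \<sigma>" by auto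
      \<comment> \<open>Since \<open>\<sigma>\<close> has a preimage, it was captured by the first
        disjunct.\<close>
      then have "prefix_of X (length \<sigma>) \<in> preimages \<sigma>"
        by (simp add: preimages_def agreement_mem_cylinder_iff)
      with \<sigma> have "agreement X (prod_encode (i, s))" "\<forall>j\<le>i. ap j s = A j"
        by (auto simp: capture_def cylinder_def)
      then show "X \<in> cylinder (prefix_of A (Suc i))"
        by (simp add: cylinder_def less_Suc_eq_le)
    qed
    then have "measure agreement_measure (?U i) \<le> measure cantor_lebesgue (cylinder (prefix_of A (Suc i)))"
      unfolding measure_agreement_measure[OF U] using cylinder_sets_lebesgue
      by (rule finite_measure_mono)
    also have "\<dots> \<le> (1/2) ^ i" by (simp add: measure_lebesgue_cylinder)
    finally show ?thesis .
  qed
  with Sigma show ?thesis unfolding martin_loef_test_def by blast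
qed

text \<open>Escaping the second disjunct at some level gives every prefix of \<open>Y\<close> a
  preimage, so by compactness \<open>Y\<close> is in the range; escaping the first rules out
  \<open>A\<close> as its preimage. Any other preimage makes \<open>Y\<close> an atom.\<close>

lemma MLR_in_A_subset_Atoms: "MLR_in agreement_measure A \<subseteq> Atoms agreement_measure"
proof
  fix Y assume Y: "Y \<in> MLR_in agreement_measure A"
  then have "Y \<notin> (\<Inter>i. \<Union>\<sigma>\<in>{\<sigma>. \<exists>s. capture i \<sigma> s}. cylinder \<sigma>)"
    unfolding MLR_in_def mem_Collect_eq by (elim allE impE) (rule capture_test)
  then obtain i where i: "\<And>\<sigma> s. Y \<in> cylinder \<sigma> \<Longrightarrow> \<not> capture i \<sigma> s"
    by auto
  have "preimages (prefix_of Y n) \<noteq> {}" for n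
    using i[OF mem_cylinder_prefix_of] by (simp add: capture_def)
  then obtain X where X: "Y = agreement X"
    using agreement_range[of Y] by (auto simp: preimages_def)
  have "X \<noteq> A"
  proof
    assume "X = A"
    from ap_agrees obtain s where "i \<le> s" "\<forall>j\<le>i. ap j s = A j" by blast
    \<comment> \<open>The prefix is just long enough to contain the bit at
      \<open>prod_encode (i, s)\<close>, which is true for the image of \<open>A\<close>.\<close>
    then have "capture i (prefix_of Y (Suc (prod_encode (i, s)))) s"
      by (auto simp: capture_def X \<open>X = A\<close>)
    with i[OF mem_cylinder_prefix_of] show False by blast
  qed
  with X agreement_mem_Atoms show "Y \<in> Atoms agreement_measure" by simp
qed

end

text \<open>A point in all levels of a test has measure at most \<open>(1/2) ^ i\<close> for every
  \<open>i\<close>, hence measure 0, whatever the oracle.\<close>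

lemma Atoms_subset_MLR_in:
  assumes "cantor_prob \<mu>"
  shows "Atoms \<mu> \<subseteq> MLR_in \<mu> A"
  unfolding MLR_in_def
proof (intro subsetI CollectI allI impI notI)
  interpret prob_space \<mu> using assms by (simp add: cantor_prob_def)
  fix X U assume X: "X \<in> Atoms \<mu>" and U: "martin_loef_test \<mu> A U" and "X \<in> (\<Inter>i. U i)"
  have "measure \<mu> {X} \<le> (1/2) ^ i" for i
  proof -
    have "U i \<in> sets \<mu>"
      using uniformly_Sigma01_in_measurable[OF assms] U unfolding martin_loef_test_def by blast
    then have "measure \<mu> {X} \<le> measure \<mu> (U i)"
      using \<open>X \<in> (\<Inter>i. U i)\<close> by (intro finite_measure_mono) auto
    also have "\<dots> \<le> (1/2) ^ i" using U by (simp add: martin_loef_test_def)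
    finally show ?thesis .
  qed
  then have "measure \<mu> {X} \<le> 0"
    by (intro tendsto_lowerbound[OF LIMSEQ_power_zero[of "1/2 :: real"]]) auto
  with X show False by (simp add: Atoms_def)
qed

theorem theorem4p1:
  fixes A :: "nat \<Rightarrow> bool"
  assumes "Delta02 A"
    and "A \<in> MLR cantor_lebesgue"
  shows "\<exists>\<mu> :: (nat \<Rightarrow> bool) measure.
    cantor_prob \<mu> \<and> computable_measure \<mu> \<and> trivial_measure \<mu> \<and>
    MLR_in \<mu> A = Atoms \<mu> \<and>
    MLR \<mu> - MLR_in \<mu> A \<noteq> {}"
proof -
  obtain ap where "limit_approximation A ap"
    using Delta02_limit[OF assms(1)] unfolding limit_approximation_def by metis
  then interpret limit_approximation A ap .
  have MLR_in: "MLR_in agreement_measure A = Atoms agreement_measure"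
    using MLR_in_A_subset_Atoms Atoms_subset_MLR_in[OF cantor_prob_agreement_measure] by blast
  \<comment> \<open>The image of \<open>A\<close> separates the two notions: it inherits randomness
    from \<open>A\<close>, but is no atom and so not random relative to \<open>A\<close>.\<close>
  moreover have "agreement A \<in> MLR agreement_measure - MLR_in agreement_measure A"
    using agreement_mem_MLR[OF assms(2)] agreement_A_notin_Atoms by (simp add: MLR_in)
  ultimately show ?thesis
    using cantor_prob_agreement_measure computable_agreement_measure trivial_agreement_measure
    by blast
qed

end
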